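(* Let $A_j$ ($j=0,\dots,\kappa-1$) be $n\times n$ matrices, $B$ an $n\times r$ matrix, $U\subseteq\mathbb{R}^r$ a convex set, and let $$F(x,v_1,\dots,v_{\kappa-1})=A_0x+\sum_{j=1}^{\kappa-1}A_jv_j+BU$$ (a convex set-valued mapping). Let $\varphi:(\mathbb{R}^n)^\kappa\to\mathbb{R}^1$ be a continuous proper convex function and $Q_j\subseteq\mathbb{R}^n$, $j=0,\dots,\kappa-1$, convex sets. Consider the problem $(P_{SL})$: minimize $\varphi\big(x(1),x'(1),\dots,x^{(\kappa-1)}(1)\big)$ subject to $$x^{(\kappa)}(t)\in F\big(x(t),x'(t),\dots,x^{(\kappa-1)}(t)\big)\ \text{a.e. }t\in[0,1],\qquad x^{(j)}(0)\in Q_j,\ j=0,\dots,\kappa-1.$$ Then for the optimality of the feasible trajectory $\tilde x(t)$ corresponding to the controlling parameter $\tilde u(t)\in U$ in $(P_{SL})$ it is sufficient that there exists a function $x^*(t)$, $t\in[0,1]$, absolutely continuous together with its derivatives up to order $\kappa-1$, satisfying: (a) the Euler–Lagrange equation, a.e. $t\in[0,1]$, $$(-1)^\kappa\frac{d^\kappa x^*(t)}{dt^\kappa}=A_0^*x^*(t)-A_1^*x^{*\prime}(t)+\cdots+(-1)^{\kappa-1}A_{\kappa-1}^*x^{*(\kappa-1)}(t);$$ (b) $(-1)^{j+1}x^{*(j)}(0)+\eta_j^*(0)\in K^*_{Q_{\kappa-j-1}}\big(\tilde x^{(\kappa-j-1)}(0)\big)$ for $j=1,\dots,\kappa-1$,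 and $-x^*(0)\in K^*_{Q_{\kappa-1}}\big(\tilde x^{(\kappa-1)}(0)\big)$; (c) $\Big((-1)^\kappa x^{*(\kappa-1)}(1)+\eta_{\kappa-1}^*(1),\ (-1)^{\kappa-1}x^{*(\kappa-2)}(1)+\eta_{\kappa-2}^*(1),\dots,x^{*\prime}(1)+\eta_1^*(1),\ -x^*(1)\Big)\in\partial\varphi\big(\tilde x(1),\dots,\tilde x^{(\kappa-1)}(1)\big)$; (d) the Weierstrass–Pontryagin maximum principle $\langle B\tilde u(t),x^*(t)\rangle=\sup_{u\in U}\langle Bu,x^*(t)\rangle$ for a.e. $t\in[0,1]$, where $\eta_j^*(t)=A_{\kappa-j}^*x^*(t)-A_{\kappa-j+1}^*x^{*\prime}(t)+\cdots+(-1)^{j-1}A_{\kappa-1}^*x^{*(j-1)}(t)$, $j=1,\dots,\kappa-1$.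
   Context: $\kappa\ge1$ is a fixed natural number. Feasible trajectories are functions $x:[0,1]\to\mathbb{R}^n$ absolutely continuous together with their derivatives up to order $\kappa-1$, with $x^{(\kappa)}\in L_1^n([0,1])$, satisfying the constraints. The trajectory $\tilde x$ corresponds to $\tilde u(t)\in U$ if $\tilde x^{(\kappa)}(t)=A_0\tilde x(t)+\sum_{j=1}^{\kappa-1}A_j\tilde x^{(j)}(t)+B\tilde u(t)$ a.e. Also $x^{*(\kappa)}\in L_1^n([0,1])$. Convention: $\eta_0^*\equiv0$ (for $\kappa=1$ the tuple in (c) is just $-x^*(1)$). $A_j^*$ denotes the transpose. For a convex set $Q$ and $x\in Q$, $K_Q(x)=\{\lambda(y-x):y\in Q,\lambda>0\}$ and $K_Q^*(x)=\{x^*:\langle\bar x,x^*\rangle\ge0\ \forall\bar x\in K_Q(x)\}$. $\partial\varphi$ is the convex subdifferential. *)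

theory Defs
  imports "HOL-Analysis.Analysis"
begin

definition absolutely_continuous_on :: "real set \<Rightarrow> (real \<Rightarrow> 'a::real_normed_vector) \<Rightarrow> bool" where
  "absolutely_continuous_on S f \<longleftrightarrow>
     (\<forall>e>0. \<exists>d>0. \<forall>P. finite P \<longrightarrow> (\<forall>(a, b)\<in>P. a \<le> b \<and> {a..b} \<subseteq> S) \<longrightarrow>
        disjoint_family_on (\<lambda>(a, b). {a<..<b}) P \<longrightarrow>
        (\<Sum>(a, b)\<in>P. b - a) < d \<longrightarrow> (\<Sum>(a, b)\<in>P. norm (f b - f a)) < e)"

(* Derivatives are taken within [0,1], hence one-sided at 0 and 1. At points where the derivative
   does not exist (and outside [0,1]) the value is unspecified. *)
fun nderiv :: "nat \<Rightarrow> (real \<Rightarrow> 'a::real_normed_vector) \<Rightarrow> real \<Rightarrow> 'a" where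
  "nderiv 0 x = x"
| "nderiv (Suc j) x = (\<lambda>t. vector_derivative (nderiv j x) (at t within {0..1}))"

(* x is absolutely continuous on [0,1] together with its derivatives up to order k-1, and the
   k-th derivative is in L_1; meant for k >= 1. The third conjunct says that the k-th derivative
   exists a.e.; by Lebesgue's theorem it follows from the second one, and it is spelled out
   because "nderiv k x" is a total function. *)
definition trajectory_regular :: "nat \<Rightarrow> (real \<Rightarrow> real^'n) \<Rightarrow> bool" where
  "trajectory_regular k x \<longleftrightarrow>
     (\<forall>j<k - 1. \<forall>t\<in>{0..1}. nderiv j x differentiable (at t within {0..1})) \<and>
     (\<forall>j<k. absolutely_continuous_on {0..1} (nderiv j x)) \<and>
     (AE t\<in>{0..1} in lebesgue. nderiv (k - 1) x differentiable (at t within {0..1})) \<and>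
     nderiv k x absolutely_integrable_on {0..1}"

(* F(v_0, ..., v_{k-1}); only the values v j with j < k are used. *)
definition semilinear_map ::
  "nat \<Rightarrow> (nat \<Rightarrow> real^'n^'n) \<Rightarrow> real^'r^'n \<Rightarrow> (real^'r) set \<Rightarrow> (nat \<Rightarrow> real^'n) \<Rightarrow> (real^'n) set" where
  "semilinear_map k A B U v = {A 0 *v v 0 + (\<Sum>j=1..k-1. A j *v v j) + B *v u |u. u \<in> U}"

definition feasible ::
  "nat \<Rightarrow> (nat \<Rightarrow> real^'n^'n) \<Rightarrow> real^'r^'n \<Rightarrow> (real^'r) set \<Rightarrow> (nat \<Rightarrow> (real^'n) set)
     \<Rightarrow> (real \<Rightarrow> real^'n) \<Rightarrow> bool" where
  "feasible k A B U Q x \<longleftrightarrow>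
     trajectory_regular k x \<and>
     (AE t\<in>{0..1} in lebesgue. nderiv k x t \<in> semilinear_map k A B U (\<lambda>j. nderiv j x t)) \<and>
     (\<forall>j<k. nderiv j x 0 \<in> Q j)"

definition corresponds_to_control ::
  "nat \<Rightarrow> (nat \<Rightarrow> real^'n^'n) \<Rightarrow> real^'r^'n \<Rightarrow> (real^'r) set
     \<Rightarrow> (real \<Rightarrow> real^'n) \<Rightarrow> (real \<Rightarrow> real^'r) \<Rightarrow> bool" where
  "corresponds_to_control k A B U x u \<longleftrightarrow>
     (\<forall>t\<in>{0..1}. u t \<in> U) \<and>
     (AE t\<in>{0..1} in lebesgue.
        nderiv k x t = A 0 *v x t + (\<Sum>j=1..k-1. A j *v nderiv j x t) + B *v u t)"

(* (R^n)^k is rendered as real^'n^'k; the enumeration pos of the index type 'k tells which slot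
   (counted from 0) a coordinate is, so this is the vector (x(1), x'(1), ..., x^(k-1)(1)). *)
definition endpoint :: "('k::finite \<Rightarrow> nat) \<Rightarrow> (real \<Rightarrow> real^'n) \<Rightarrow> real^'n^'k" where
  "endpoint pos x = (\<chi> i. nderiv (pos i) x 1)"

definition optimal ::
  "nat \<Rightarrow> ('k::finite \<Rightarrow> nat) \<Rightarrow> (nat \<Rightarrow> real^'n^'n) \<Rightarrow> real^'r^'n \<Rightarrow> (real^'r) set
     \<Rightarrow> (nat \<Rightarrow> (real^'n) set) \<Rightarrow> (real^'n^'k \<Rightarrow> real) \<Rightarrow> (real \<Rightarrow> real^'n) \<Rightarrow> bool" where
  "optimal k pos A B U Q \<phi> x \<longleftrightarrow>
     feasible k A B U Q x \<and>
     (\<forall>y. feasible k A B U Q y \<longrightarrow> \<phi> (endpoint pos x) \<le> \<phi> (endpoint pos y))"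

definition tangent_cone :: "'a::real_inner set \<Rightarrow> 'a \<Rightarrow> 'a set" where
  "tangent_cone Q x = {c *\<^sub>R (y - x) |c y. y \<in> Q \<and> c > 0}"

definition dual_tangent_cone :: "'a::real_inner set \<Rightarrow> 'a \<Rightarrow> 'a set" where
  "dual_tangent_cone Q x = {w. \<forall>z\<in>tangent_cone Q x. inner z w \<ge> 0}"

definition subdifferential :: "('a::real_inner \<Rightarrow> real) \<Rightarrow> 'a \<Rightarrow> 'a set" where
  "subdifferential f x = {w. \<forall>z. f z - f x \<ge> inner w (z - x)}"

(* The empty sum gives eta k A xs 0 = 0. *)
definition eta :: "nat \<Rightarrow> (nat \<Rightarrow> real^'n^'n) \<Rightarrow> (real \<Rightarrow> real^'n) \<Rightarrow> nat \<Rightarrow> real \<Rightarrow> real^'n" where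
  "eta k A xs j t = (\<Sum>i<j. (-1) ^ i *\<^sub>R (transpose (A (k - j + i)) *v nderiv i xs t))"

end

theory Submission
  imports Defs
begin

text \<open>
  Write \<open>\<psi>\<close> for the dual function and \<open>f^(j)\<close> for a derivative of order \<open>j\<close>, and put
  \<open>p m = (-1)^(m+1) \<psi>^(m) + \<eta> m\<close> with \<open>\<eta> 0 = 0\<close>. These are the adjoint variables of the first-order
  system satisfied by \<open>(x, x', \<dots>, x^(\<kappa>-1))\<close>, with \<open>p m\<close> dual to \<open>x^(\<kappa>-1-m)\<close>: the \<open>\<eta> m\<close> are built so
  that \<open>(p m)' = transpose (A (\<kappa>-1-m)) \<psi> - p (m+1)\<close>, and the Euler--Lagrange equation says exactly that
  this chain closes with \<open>p \<kappa> = 0\<close>. The initial and terminal conditions are conditions on the values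
  of the \<open>p m\<close> at \<open>0\<close> and at \<open>1\<close>.

  Given a feasible \<open>y\<close>, let \<open>z = y - x\<close>, and let \<open>\<Phi>\<close> be the sum over \<open>m < \<kappa>\<close> of the inner products of \<open>p m\<close>
  with \<open>z^(\<kappa>-1-m)\<close>. On differentiating, the terms with \<open>p (m+1)\<close> telescope, and \<open>\<Phi>'\<close> is minus the inner
  product of \<open>\<psi>\<close> with \<open>z^(\<kappa>) - (\<Sum>j<\<kappa>. A j z^(j))\<close> (lemma \<open>costate_pairing_has_vector_derivative\<close>). If
  \<open>v\<close> is a control value producing \<open>y\<close> at a time \<open>t\<close>, that vector is \<open>B v - B u\<close>, so \<open>\<Phi>' \<ge> 0\<close> almost
  everywhere by the maximum principle, and therefore \<open>\<Phi> 0 \<le> \<Phi> 1\<close>. The cone conditions give \<open>\<Phi> 0 \<ge> 0\<close>,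
  while the subgradient inequality bounds \<open>\<Phi> 1\<close> by the cost of \<open>y\<close> minus the cost of \<open>x\<close>.

  Since \<open>\<Phi>'\<close> is known only almost everywhere, the step to \<open>\<Phi> 0 \<le> \<Phi> 1\<close> rests on the absolute continuity
  of \<open>\<Phi>\<close> (lemma \<open>absolutely_continuous_on_nondecreasing\<close>). Only the sign of \<open>\<Phi>'\<close> at almost every point
  enters, so the control values of \<open>y\<close> can be chosen point by point, without a measurable selection.
\<close>

section \<open>Absolutely continuous functions\<close>

lemma absolutely_continuous_onE:
  assumes "absolutely_continuous_on S f" "e > 0"
  obtains d where "d > 0" "\<And>P. finite P \<Longrightarrow> \<forall>(a, b)\<in>P. a \<le> b \<and> {a..b} \<subseteq> S \<Longrightarrow>
    disjoint_family_on (\<lambda>(a, b). {a<..<b}) P \<Longrightarrow>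
    (\<Sum>(a, b)\<in>P. b - a) < d \<Longrightarrow> (\<Sum>(a, b)\<in>P. norm (f b - f a)) < e"
proof -
  have "\<exists>d>0. \<forall>P. finite P \<longrightarrow> (\<forall>(a, b)\<in>P. a \<le> b \<and> {a..b} \<subseteq> S) \<longrightarrow>
    disjoint_family_on (\<lambda>(a, b). {a<..<b}) P \<longrightarrow>
    (\<Sum>(a, b)\<in>P. b - a) < d \<longrightarrow> (\<Sum>(a, b)\<in>P. norm (f b - f a)) < e"
    using assms(1)[unfolded absolutely_continuous_on_def, rule_format, OF assms(2)] .
  then show thesis
    using that by (elim exE conjE) simp
qed

text \<open>Sums, differences, linear images and inner products are all covered by this comparison of
  increments.\<close>

lemma absolutely_continuous_on_dominated:
  assumes f: "absolutely_continuous_on S f" and g: "absolutely_continuous_on S g"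
    and dom: "\<And>a b. a \<le> b \<Longrightarrow> {a..b} \<subseteq> S \<Longrightarrow>
      norm (h b - h a) \<le> C * (norm (f b - f a) + norm (g b - g a))"
  shows "absolutely_continuous_on S h"
  unfolding absolutely_continuous_on_def
proof (intro allI impI)
  fix e :: real assume "e > 0"
  \<comment> \<open>a positive substitute for \<open>C\<close>, which may be zero or negative\<close>
  define C' where "C' = \<bar>C\<bar> + 1"
  have "C' > 0" "C \<le> C'" by (auto simp: C'_def)
  define e' where "e' = e / (2 * C')"
  have "e' > 0" using \<open>e > 0\<close> \<open>C' > 0\<close> by (simp add: e'_def)
  obtain df where df: "df > 0" "\<And>P. finite P \<Longrightarrow> \<forall>(a, b)\<in>P. a \<le> b \<and> {a..b} \<subseteq> S \<Longrightarrow>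
        disjoint_family_on (\<lambda>(a, b). {a<..<b}) P \<Longrightarrow>
        (\<Sum>(a, b)\<in>P. b - a) < df \<Longrightarrow> (\<Sum>(a, b)\<in>P. norm (f b - f a)) < e'"
    by (rule absolutely_continuous_onE[OF f \<open>e' > 0\<close>]) (rule that; simp)
  obtain dg where dg: "dg > 0" "\<And>P. finite P \<Longrightarrow> \<forall>(a, b)\<in>P. a \<le> b \<and> {a..b} \<subseteq> S \<Longrightarrow>
        disjoint_family_on (\<lambda>(a, b). {a<..<b}) P \<Longrightarrow>
        (\<Sum>(a, b)\<in>P. b - a) < dg \<Longrightarrow> (\<Sum>(a, b)\<in>P. norm (g b - g a)) < e'"
    by (rule absolutely_continuous_onE[OF g \<open>e' > 0\<close>]) (rule that; simp)
  show "\<exists>d>0. \<forall>P. finite P \<longrightarrow> (\<forall>(a, b)\<in>P. a \<le> b \<and> {a..b} \<subseteq> S) \<longrightarrow>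
        disjoint_family_on (\<lambda>(a, b). {a<..<b}) P \<longrightarrow>
        (\<Sum>(a, b)\<in>P. b - a) < d \<longrightarrow> (\<Sum>(a, b)\<in>P. norm (h b - h a)) < e"
  proof (intro exI[of _ "min df dg"] conjI allI impI)
    show "min df dg > 0" using df(1) dg(1) by simp
    fix P :: "(real \<times> real) set"
    assume P: "finite P" "\<forall>(a, b)\<in>P. a \<le> b \<and> {a..b} \<subseteq> S"
      "disjoint_family_on (\<lambda>(a, b). {a<..<b}) P" "(\<Sum>(a, b)\<in>P. b - a) < min df dg"
    have "(\<Sum>(a, b)\<in>P. norm (h b - h a))
        \<le> (\<Sum>(a, b)\<in>P. C' * (norm (f b - f a) + norm (g b - g a)))"
    proof (rule sum_mono, clarify)
      fix a b assume "(a, b) \<in> P"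
      then have "norm (h b - h a) \<le> C * (norm (f b - f a) + norm (g b - g a))"
        using P(2) by (intro dom) auto
      also have "\<dots> \<le> C' * (norm (f b - f a) + norm (g b - g a))"
        using \<open>C \<le> C'\<close> by (intro mult_right_mono) auto
      finally show "norm (h b - h a) \<le> C' * (norm (f b - f a) + norm (g b - g a))" .
    qed
    also have "\<dots> = C' * ((\<Sum>(a, b)\<in>P. norm (f b - f a)) + (\<Sum>(a, b)\<in>P. norm (g b - g a)))"
      by (simp add: split_def sum_distrib_left sum.distrib distrib_left)
    also have "\<dots> < C' * (e' + e')"
      using df(2)[OF P(1-3)] dg(2)[OF P(1-3)] P(4) \<open>C' > 0\<close>
      by (intro mult_strict_left_mono add_strict_mono) auto
    also have "\<dots> = e" using \<open>C' > 0\<close> by (simp add: e'_def)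
    finally show "(\<Sum>(a, b)\<in>P. norm (h b - h a)) < e" .
  qed
qed

lemma absolutely_continuous_on_add:
  assumes "absolutely_continuous_on S f" "absolutely_continuous_on S g"
  shows "absolutely_continuous_on S (\<lambda>t. f t + g t)"
  by (rule absolutely_continuous_on_dominated[OF assms, where C = 1])
     (simp add: add_diff_add norm_triangle_ineq)

lemma absolutely_continuous_on_diff:
  assumes "absolutely_continuous_on S f" "absolutely_continuous_on S g"
  shows "absolutely_continuous_on S (\<lambda>t. f t - g t)"
proof (rule absolutely_continuous_on_dominated[OF assms, where C = 1])
  fix a b
  show "norm (f b - g b - (f a - g a)) \<le> 1 * (norm (f b - f a) + norm (g b - g a))"
    using norm_triangle_ineq4[of "f b - f a" "g b - g a"] by (simp add: algebra_simps)
qed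

lemma absolutely_continuous_on_const: "absolutely_continuous_on S (\<lambda>t. c)"
  unfolding absolutely_continuous_on_def by (auto simp: split_def intro: exI[of _ 1])

lemma absolutely_continuous_on_sum:
  "(\<And>i. i \<in> I \<Longrightarrow> absolutely_continuous_on S (f i)) \<Longrightarrow>
    absolutely_continuous_on S (\<lambda>t. \<Sum>i\<in>I. f i t)"
  by (induction I rule: infinite_finite_induct)
     (auto intro: absolutely_continuous_on_const absolutely_continuous_on_add)

lemma absolutely_continuous_on_bounded_linear:
  assumes "bounded_linear L" "absolutely_continuous_on S f"
  shows "absolutely_continuous_on S (\<lambda>t. L (f t))"
proof -
  interpret bounded_linear L by fact
  obtain K where K: "K > 0" "\<And>v. norm (L v) \<le> norm v * K" using pos_bounded by blast
  show ?thesis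
  proof (rule absolutely_continuous_on_dominated[OF assms(2) assms(2), where C = K])
    fix a b
    have "norm (L (f b) - L (f a)) \<le> norm (f b - f a) * K"
      using K(2)[of "f b - f a"] by (simp add: diff)
    also have "\<dots> \<le> K * (norm (f b - f a) + norm (f b - f a))"
      using K(1) by simp
    finally show "norm (L (f b) - L (f a)) \<le> \<dots>" .
  qed
qed

lemma absolutely_continuous_on_imp_continuous_on:
  assumes f: "absolutely_continuous_on {a..b} f"
  shows "continuous_on {a..b} f"
  unfolding continuous_on_iff
proof (intro ballI allI impI)
  fix s e :: real assume s: "s \<in> {a..b}" and "e > 0"
  obtain d where d: "d > 0" "\<And>P. finite P \<Longrightarrow> \<forall>(c, e)\<in>P. c \<le> e \<and> {c..e} \<subseteq> {a..b} \<Longrightarrow>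
        disjoint_family_on (\<lambda>(a, b). {a<..<b}) P \<Longrightarrow>
        (\<Sum>(a, b)\<in>P. b - a) < d \<Longrightarrow> (\<Sum>(a, b)\<in>P. norm (f b - f a)) < e"
    by (rule absolutely_continuous_onE[OF f \<open>e > 0\<close>]) (rule that; simp)
  have "dist (f t) (f s) < e" if t: "t \<in> {a..b}" "dist t s < d" for t
    using d(2)[of "{(min s t, max s t)}"] s t
    by (cases "s \<le> t") (auto simp: dist_norm norm_minus_commute disjoint_family_on_def)
  then show "\<exists>d>0. \<forall>t\<in>{a..b}. dist t s < d \<longrightarrow> dist (f t) (f s) < e"
    using d(1) by blast
qed

lemma absolutely_continuous_on_inner:
  assumes f: "absolutely_continuous_on {a..b} f" and g: "absolutely_continuous_on {a..b} g"
  shows "absolutely_continuous_on {a..b} (\<lambda>t. inner (f t) (g t))"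
proof -
  have "bounded (f ` {a..b})" "bounded (g ` {a..b})"
    by (intro compact_imp_bounded compact_continuous_image compact_Icc
        absolutely_continuous_on_imp_continuous_on f g)+
  then obtain Mf Mg where
    M: "\<And>t. t \<in> {a..b} \<Longrightarrow> norm (f t) \<le> Mf" "\<And>t. t \<in> {a..b} \<Longrightarrow> norm (g t) \<le> Mg"
    unfolding bounded_iff by blast
  show ?thesis
  proof (rule absolutely_continuous_on_dominated[OF f g, where C = "max Mf Mg"])
    fix c e assume "c \<le> e" "{c..e} \<subseteq> {a..b}"
    then have ce: "c \<in> {a..b}" "e \<in> {a..b}" by auto
    have "inner (f e) (g e) - inner (f c) (g c)
        = inner (f e - f c) (g e) + inner (f c) (g e - g c)"
      by (simp add: inner_diff_left inner_diff_right)
    also have "norm \<dots> \<le> norm (f e - f c) * norm (g e) + norm (f c) * norm (g e - g c)"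
      by (intro order.trans[OF norm_triangle_ineq] add_mono)
         (simp_all add: Cauchy_Schwarz_ineq2)
    also have "\<dots> \<le> norm (f e - f c) * max Mf Mg + max Mf Mg * norm (g e - g c)"
      using M[OF ce(1)] M[OF ce(2)]
      by (intro add_mono mult_left_mono mult_right_mono) auto
    finally show "norm (inner (f e) (g e) - inner (f c) (g c))
        \<le> max Mf Mg * (norm (f e - f c) + norm (g e - g c))"
      by (simp add: algebra_simps)
  qed
qed

text \<open>Take a tagged division that is fine for a suitable gauge. An interval tagged where the derivative
  exists decreases \<open>f\<close> by at most \<open>\<epsilon>\<close> times its length, by the definition of a nonnegative derivative.
  The intervals tagged in the exceptional null set \<open>N\<close> lie in an open set of small measure, and
  absolute continuity makes the sum of their increments small.\<close>

lemma absolutely_continuous_on_nondecreasing: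
  fixes f :: "real \<Rightarrow> real"
  assumes "a \<le> b" and ac: "absolutely_continuous_on {a..b} f"
    and ae: "AE t\<in>{a..b} in lebesgue. \<exists>D\<ge>0. (f has_vector_derivative D) (at t within {a..b})"
  shows "f a \<le> f b"
proof (rule field_le_epsilon)
  fix e :: real assume "e > 0"
  \<comment> \<open>the summand \<open>1\<close> keeps the denominator positive when \<open>a = b\<close>\<close>
  define \<epsilon> where "\<epsilon> = e / (2 * (b - a + 1))"
  have "\<epsilon> > 0" using \<open>e > 0\<close> \<open>a \<le> b\<close> by (simp add: \<epsilon>_def)
  have \<epsilon>_le: "\<epsilon> * (b - a) \<le> e / 2"
    using \<open>e > 0\<close> \<open>a \<le> b\<close> by (simp add: \<epsilon>_def field_simps)
  obtain d where d: "d > 0" "\<And>P. finite P \<Longrightarrow> \<forall>(c, e)\<in>P. c \<le> e \<and> {c..e} \<subseteq> {a..b} \<Longrightarrow>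
        disjoint_family_on (\<lambda>(a, b). {a<..<b}) P \<Longrightarrow>
        (\<Sum>(a, b)\<in>P. b - a) < d \<Longrightarrow> (\<Sum>(a, b)\<in>P. norm (f b - f a)) < e / 2"
    by (rule absolutely_continuous_onE[OF ac half_gt_zero[OF \<open>e > 0\<close>]]) (rule that; simp)
  obtain N where N: "negligible N"
    and deriv: "\<And>t. t \<in> {a..b} - N \<Longrightarrow>
      \<exists>D\<ge>0. (f has_vector_derivative D) (at t within {a..b})"
    using ae unfolding eventually_ae_filter_negligible by blast
  obtain G where G: "open G" "N \<subseteq> G" "G \<in> lmeasurable" "measure lebesgue G < d"
  proof -
    have "N \<in> sets lebesgue" "emeasure lebesgue N = 0"
      using N by (auto simp: negligible_iff_null_sets)
    then obtain G where "open G" "N \<subseteq> G" "G - N \<in> lmeasurable" "emeasure lebesgue (G - N) < ennreal d"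
      using sets_lebesgue_outer_open[of N d] \<open>d > 0\<close> by blast
    moreover have "emeasure lebesgue G = emeasure lebesgue (G - N)"
      using N \<open>open G\<close> by (metis borel_open emeasure_Diff_null_set negligible_iff_null_sets
          sets_completionI_sets sets_lborel)
    ultimately show ?thesis
      using that[of G] \<open>d > 0\<close>
      by (auto simp: fmeasurable_def measure_def enn2real_less_iff less_top[symmetric]
          intro: order.strict_trans)
  qed
  have "\<exists>r>0. (t \<in> N \<longrightarrow> ball t r \<subseteq> G) \<and> (t \<in> {a..b} - N \<longrightarrow>
      (\<exists>D\<ge>0. \<forall>s\<in>{a..b}. \<bar>s - t\<bar> < r \<longrightarrow> \<bar>f s - f t - (s - t) * D\<bar> \<le> \<epsilon> * \<bar>s - t\<bar>))" for t
  proof (cases "t \<in> {a..b} - N")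
    case True
    then obtain D where D: "D \<ge> 0" "(f has_vector_derivative D) (at t within {a..b})"
      using deriv by blast
    then have "\<exists>r>0. \<forall>s\<in>{a..b}. \<bar>s - t\<bar> < r \<longrightarrow> \<bar>f s - f t - (s - t) * D\<bar> \<le> \<epsilon> * \<bar>s - t\<bar>"
      using \<open>\<epsilon> > 0\<close> unfolding has_vector_derivative_def has_derivative_within_alt by auto
    then show ?thesis
      using D(1) True by blast
  next
    case False
    then show ?thesis
      using G(1,2) by (metis open_contains_ball subsetD zero_less_one)
  qed
  then obtain r where r: "\<And>t. r t > 0" "\<And>t. t \<in> N \<Longrightarrow> ball t (r t) \<subseteq> G"
    "\<And>t. t \<in> {a..b} - N \<Longrightarrow>
      \<exists>D\<ge>0. \<forall>s\<in>{a..b}. \<bar>s - t\<bar> < r t \<longrightarrow> \<bar>f s - f t - (s - t) * D\<bar> \<le> \<epsilon> * \<bar>s - t\<bar>"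
    by metis
  have "gauge (\<lambda>t. ball t (r t))"
    using r(1) by (auto simp: gauge_def)
  then obtain p where p: "p tagged_division_of {a..b}" "(\<lambda>t. ball t (r t)) fine p"
    using fine_division_exists_real by blast
  note pD = tagged_division_ofD[OF p(1)]
  have piece: "\<exists>c e. K = {c..e} \<and> c \<le> t \<and> t \<le> e \<and> a \<le> c \<and> e \<le> b \<and> {c..e} \<subseteq> ball t (r t)"
    if tK: "(t, K) \<in> p" for t K
    using pD(2-4)[OF tK] p(2) tK unfolding fine_def
    by (auto 4 4)
  let ?\<Delta> = "\<lambda>(t, K). f (Sup K) - f (Inf K)"
  \<comment> \<open>Degenerate intervals are left out so that distinct members have distinct endpoints; they do not
    contribute to the sum of the increments anyway.\<close>
  define q where "q = {(t, K) \<in> p. t \<in> N \<and> interior K \<noteq> {}}"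
  have "q \<subseteq> p" by (auto simp: q_def)
  have "finite q" using pD(1) \<open>q \<subseteq> p\<close> by (rule rev_finite_subset)
  define ends where "ends = (\<lambda>(t::real, K::real set). (Inf K, Sup K))"
  have inj: "inj_on ends q"
  proof (rule inj_onI, clarify)
    fix s K t L assume *: "(s, K) \<in> q" "(t, L) \<in> q" "ends (s, K) = ends (t, L)"
    obtain c e where "K = {c..e}" "c \<le> e"
      using * \<open>q \<subseteq> p\<close> piece[of s K] by fastforce
    moreover obtain c' e' where "L = {c'..e'}" "c' \<le> e'"
      using * \<open>q \<subseteq> p\<close> piece[of t L] by fastforce
    ultimately have "K = L" using * by (simp add: ends_def)
    then show "s = t \<and> K = L" using * pD(5)[of s K t L] by (auto simp: q_def)
  qed
  have small: "(\<Sum>z\<in>q. \<bar>?\<Delta> z\<bar>) < e / 2"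
  proof -
    have disj: "disjoint_family_on (\<lambda>(a, b). {a<..<b}) (ends ` q)"
      unfolding disjoint_family_on_def
    proof (intro ballI impI)
      fix I J assume IJ: "I \<in> ends ` q" "J \<in> ends ` q" "I \<noteq> J"
      then obtain s K t L where *: "(s, K) \<in> q" "(t, L) \<in> q" "I = ends (s, K)" "J = ends (t, L)"
        by force
      then have "interior K \<inter> interior L = {}" using pD(5)[of s K t L] \<open>q \<subseteq> p\<close> IJ(3) by auto
      moreover obtain c e where "K = {c..e}" "c \<le> e"
        using * \<open>q \<subseteq> p\<close> piece[of s K] by fastforce
      moreover obtain c' e' where "L = {c'..e'}" "c' \<le> e'"
        using * \<open>q \<subseteq> p\<close> piece[of t L] by fastforce
      ultimately show "(case I of (a, b) \<Rightarrow> {a<..<b}) \<inter> (case J of (a, b) \<Rightarrow> {a<..<b}) = {}"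
        by (simp add: *(3,4) ends_def)
    qed
    have sub: "(\<Union>z\<in>ends ` q. case z of (a, b) \<Rightarrow> {a<..<b}) \<subseteq> G"
    proof
      fix z assume "z \<in> (\<Union>z\<in>ends ` q. case z of (a, b) \<Rightarrow> {a<..<b})"
      then obtain t K where *: "(t, K) \<in> q" "z \<in> {Inf K<..<Sup K}"
        by (auto simp: ends_def)
      then obtain c e where "K = {c..e}" "c \<le> e" "{c..e} \<subseteq> ball t (r t)"
        using piece[of t K] \<open>q \<subseteq> p\<close> by fastforce
      moreover have "t \<in> N" using * by (auto simp: q_def)
      ultimately have "z \<in> K" "K \<subseteq> G"
        using * r(2)[of t] by auto
      then show "z \<in> G" by blast
    qed
    have le: "\<forall>(c, e)\<in>ends ` q. c \<le> e \<and> {c..e} \<subseteq> {a..b}"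
      using piece \<open>q \<subseteq> p\<close> by (fastforce simp: ends_def)
    have fin: "emeasure lebesgue (case z of (c::real, e) \<Rightarrow> {c<..<e}) \<noteq> \<infinity>" for z
    proof (cases z)
      case (Pair c e)
      then show ?thesis by (cases "c \<le> e") auto
    qed
    have "(\<Sum>(c, e)\<in>ends ` q. e - c)
        = (\<Sum>z\<in>ends ` q. measure lebesgue (case z of (c, e) \<Rightarrow> {c<..<e}))"
      using le by (intro sum.cong) auto
    also have "\<dots> = measure lebesgue (\<Union>z\<in>ends ` q. case z of (a, b) \<Rightarrow> {a<..<b})"
      using \<open>finite q\<close> disj fin by (intro measure_finite_Union[symmetric]) (simp_all, auto)
    also have "\<dots> \<le> measure lebesgue G"
      using sub G(3) by (intro measure_mono_fmeasurable) (auto intro!: sets.finite_UN simp: \<open>finite q\<close> split: prod.split)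
    finally have "(\<Sum>(c, e)\<in>ends ` q. e - c) < d" using G(4) by simp
    from d(2)[OF _ le disj this] \<open>finite q\<close>
    have "(\<Sum>(c, e)\<in>ends ` q. norm (f e - f c)) < e / 2" by simp
    moreover have "(\<Sum>(c, e)\<in>ends ` q. norm (f e - f c)) = (\<Sum>z\<in>q. \<bar>?\<Delta> z\<bar>)"
      unfolding sum.reindex[OF inj] by (intro sum.cong) (auto simp: ends_def)
    ultimately show ?thesis by simp
  qed
  have good: "- (\<epsilon> * measure lebesgue (snd z)) \<le> ?\<Delta> z" if z: "z \<in> p - q" for z
  proof -
    obtain t K where tK: "z = (t, K)" by fastforce
    with z obtain c e where K: "K = {c..e}" "c \<le> t" "t \<le> e" "a \<le> c" "e \<le> b"
      "{c..e} \<subseteq> ball t (r t)" using piece[of t K] by auto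
    show ?thesis
    proof (cases "t \<in> N")
      case True
      then have "c = e" using z tK K by (auto simp: q_def)
      then show ?thesis by (simp add: tK K)
    next
      case False
      then obtain D where D: "D \<ge> 0"
        "\<And>s. s \<in> {a..b} \<Longrightarrow> \<bar>s - t\<bar> < r t \<Longrightarrow> \<bar>f s - f t - (s - t) * D\<bar> \<le> \<epsilon> * \<bar>s - t\<bar>"
        using r(3)[of t] K by auto
      have "c \<in> ball t (r t)" "e \<in> ball t (r t)"
        using K by (auto simp del: mem_ball)
      then have "\<bar>c - t\<bar> < r t" "\<bar>e - t\<bar> < r t"
        by (auto simp: dist_real_def abs_minus_commute)
      then have "\<bar>f c - f t - (c - t) * D\<bar> \<le> \<epsilon> * \<bar>c - t\<bar>"
        "\<bar>f e - f t - (e - t) * D\<bar> \<le> \<epsilon> * \<bar>e - t\<bar>"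
        using D(2)[of c] D(2)[of e] K(2-5) by simp_all
      then have "f c - f t \<le> (c - t) * D + \<epsilon> * (t - c)" "(e - t) * D - \<epsilon> * (e - t) \<le> f e - f t"
        using K(2,3) by (simp_all add: abs_le_iff)
      then have "(e - c) * D - \<epsilon> * (e - c) \<le> f e - f c"
        by (simp add: algebra_simps)
      moreover have "(e - c) * D \<ge> 0" using K D(1) by simp
      ultimately show ?thesis using K by (simp add: tK)
    qed
  qed
  have total: "(\<Sum>z\<in>p. measure lebesgue (snd z)) = b - a"
    using additive_tagged_division_1[OF \<open>a \<le> b\<close> p(1), of "\<lambda>t. t"] piece
    by (subst sum.cong[OF refl, of p _ "\<lambda>(t, K). Sup K - Inf K"]) fastforce+
  have "f b - f a = sum ?\<Delta> p"
    using additive_tagged_division_1[OF \<open>a \<le> b\<close> p(1), of f] by simp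
  also have "\<dots> = sum ?\<Delta> (p - q) + sum ?\<Delta> q"
    using \<open>q \<subseteq> p\<close> pD(1) by (rule sum.subset_diff)
  finally have split: "f b - f a = sum ?\<Delta> (p - q) + sum ?\<Delta> q" .
  have "- (\<epsilon> * (b - a)) = (\<Sum>z\<in>p. - (\<epsilon> * measure lebesgue (snd z)))"
    by (simp add: sum_negf total flip: sum_distrib_left)
  also have "\<dots> \<le> (\<Sum>z\<in>p - q. - (\<epsilon> * measure lebesgue (snd z)))"
    using sum_mono2[OF pD(1), of "p - q" "\<lambda>z. \<epsilon> * measure lebesgue (snd z)"] \<open>\<epsilon> > 0\<close>
    by (simp add: sum_negf)
  also have "\<dots> \<le> sum ?\<Delta> (p - q)"
    by (intro sum_mono good)
  finally have "- (\<epsilon> * (b - a)) \<le> sum ?\<Delta> (p - q)" .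
  moreover have "- (\<Sum>z\<in>q. \<bar>?\<Delta> z\<bar>) \<le> sum ?\<Delta> q"
    using sum_abs[of ?\<Delta> q] by linarith
  ultimately show "f a \<le> f b + e" using split small \<epsilon>_le by linarith
qed

section \<open>The adjoint system\<close>

lemma nderiv_has_vector_derivative:
  assumes "nderiv j x differentiable (at t within {0..1})"
  shows "(nderiv j x has_vector_derivative nderiv (Suc j) x t) (at t within {0..1})"
  using assms by (simp add: vector_derivative_works)

lemma trajectory_regular_derivatives:
  assumes "trajectory_regular k x"
  shows "AE t\<in>{0..1} in lebesgue. \<forall>j<k.
    (nderiv j x has_vector_derivative nderiv (Suc j) x t) (at t within {0..1})"
proof -
  have lower: "nderiv j x differentiable (at t within {0..1})" if "j < k - 1" "t \<in> {0..1}" for j t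
    using assms that unfolding trajectory_regular_def by blast
  have "AE t\<in>{0..1} in lebesgue. nderiv (k - 1) x differentiable (at t within {0..1})"
    using assms unfolding trajectory_regular_def by blast
  then show ?thesis
  proof eventually_elim
    case (elim t)
    show ?case
    proof (intro impI allI)
      fix j assume "t \<in> {0..1}" "j < k"
      moreover from \<open>j < k\<close> consider "j < k - 1" | "j = k - 1" by linarith
      ultimately show "(nderiv j x has_vector_derivative nderiv (Suc j) x t) (at t within {0..1})"
        using lower elim by cases (auto intro: nderiv_has_vector_derivative simp del: nderiv.simps)
    qed
  qed
qed

text \<open>These are the adjoint variables of the equivalent first-order system. The index
  \<open>m = k\<close> is included: it is, up to sign, the residual of the Euler--Lagrange equation.\<close>

definition costate ::
  "nat \<Rightarrow> (nat \<Rightarrow> real^'n^'n) \<Rightarrow> (real \<Rightarrow> real^'n) \<Rightarrow> nat \<Rightarrow> real \<Rightarrow> real^'n" where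
  "costate k A \<psi> m t = (-1) ^ (m + 1) *\<^sub>R nderiv m \<psi> t + eta k A \<psi> m t"

lemma costate_0: "costate k A \<psi> 0 t = - \<psi> t"
  by (simp add: costate_def eta_def)

lemma costate_top:
  assumes "(-1) ^ k *\<^sub>R nderiv k \<psi> t = (\<Sum>j<k. (-1) ^ j *\<^sub>R (transpose (A j) *v nderiv j \<psi> t))"
  shows "costate k A \<psi> k t = 0"
  using assms by (simp add: costate_def eta_def flip: assms)

text \<open>Differentiating \<open>\<eta>\<close> at \<open>m\<close> raises the order of each summand by one, which gives minus the tail of
  \<open>\<eta>\<close> at \<open>m + 1\<close>; the leading summand missing from it is the term with \<open>\<psi>\<close> itself.\<close>

lemma costate_has_vector_derivative:
  assumes "m < k"
    and \<psi>: "\<And>j. j \<le> m \<Longrightarrow>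
      (nderiv j \<psi> has_vector_derivative nderiv (Suc j) \<psi> t) (at t within {0..1})"
  shows "(costate k A \<psi> m has_vector_derivative
    transpose (A (k - Suc m)) *v \<psi> t - costate k A \<psi> (Suc m) t) (at t within {0..1})"
proof -
  have "(costate k A \<psi> m has_vector_derivative
      (-1) ^ (m + 1) *\<^sub>R nderiv (Suc m) \<psi> t +
      (\<Sum>i<m. (-1) ^ i *\<^sub>R (transpose (A (k - m + i)) *v nderiv (Suc i) \<psi> t))) (at t within {0..1})"
    unfolding costate_def[abs_def] eta_def
    by (intro has_vector_derivative_add has_vector_derivative_sum
        bounded_linear.has_vector_derivative[OF bounded_linear_scaleR_right]
        bounded_linear.has_vector_derivative[OF matrix_vector_mul_bounded_linear] \<psi>) auto
  moreover have "eta k A \<psi> (Suc m) t = transpose (A (k - Suc m)) *v \<psi> t -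
      (\<Sum>i<m. (-1) ^ i *\<^sub>R (transpose (A (k - m + i)) *v nderiv (Suc i) \<psi> t))"
  proof -
    have "k - Suc m + Suc i = k - m + i" for i using \<open>m < k\<close> by simp
    then show ?thesis
      unfolding eta_def sum.lessThan_Suc_shift
      by (simp add: sum_negf del: nderiv.simps(2) add_Suc_right)
  qed
  ultimately show ?thesis
    by (simp add: costate_def del: nderiv.simps(2))
qed

lemma costate_absolutely_continuous:
  assumes "trajectory_regular k \<psi>" "m < k"
  shows "absolutely_continuous_on {0..1} (costate k A \<psi> m)"
proof -
  have ac: "absolutely_continuous_on {0..1} (nderiv j \<psi>)" if "j \<le> m" for j
    using assms that unfolding trajectory_regular_def by auto
  show ?thesis
    unfolding costate_def[abs_def] eta_def
    by (intro absolutely_continuous_on_add absolutely_continuous_on_sum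
        absolutely_continuous_on_bounded_linear[OF bounded_linear_scaleR_right]
        absolutely_continuous_on_bounded_linear[OF matrix_vector_mul_bounded_linear] ac) auto
qed

text \<open>This is the integration by parts of order \<open>k\<close> behind the duality, in differential form. The functions
  \<open>z j\<close> play the role of successive derivatives; they form an arbitrary chain so that differences of the
  derivatives of two trajectories can be used directly.\<close>

lemma costate_pairing_has_vector_derivative:
  assumes \<psi>: "\<And>j. j < k \<Longrightarrow>
      (nderiv j \<psi> has_vector_derivative nderiv (Suc j) \<psi> t) (at t within {0..1})"
    and EL: "(-1) ^ k *\<^sub>R nderiv k \<psi> t = (\<Sum>j<k. (-1) ^ j *\<^sub>R (transpose (A j) *v nderiv j \<psi> t))"
    and z: "\<And>j. j < k \<Longrightarrow> (z j has_vector_derivative z (Suc j) t) (at t within {0..1})"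
  shows "((\<lambda>t. \<Sum>m<k. inner (costate k A \<psi> m t) (z (k - Suc m) t)) has_vector_derivative
    - inner (\<psi> t) (z k t - (\<Sum>j<k. A j *v z j t))) (at t within {0..1})"
proof -
  let ?p = "\<lambda>m. costate k A \<psi> m t"
  let ?d = "\<lambda>m. inner (?p m) (z (k - m) t) - inner (?p (Suc m)) (z (k - Suc m) t)
      + inner (\<psi> t) (A (k - Suc m) *v z (k - Suc m) t)"
  have "((\<lambda>t. \<Sum>m<k. inner (costate k A \<psi> m t) (z (k - Suc m) t)) has_vector_derivative
      (\<Sum>m<k. ?d m)) (at t within {0..1})"
  proof (rule has_vector_derivative_sum)
    fix m assume "m \<in> {..<k}"
    then have "m < k" and k: "Suc (k - Suc m) = k - m" by auto
    have "((\<lambda>t. inner (costate k A \<psi> m t) (z (k - Suc m) t)) has_vector_derivative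
        inner (?p m) (z (Suc (k - Suc m)) t)
        + inner (transpose (A (k - Suc m)) *v \<psi> t - ?p (Suc m)) (z (k - Suc m) t)) (at t within {0..1})"
      using \<open>m < k\<close>
      by (intro bounded_bilinear.has_vector_derivative[OF bounded_bilinear_inner]
          costate_has_vector_derivative \<psi> z) auto
    then show "((\<lambda>t. inner (costate k A \<psi> m t) (z (k - Suc m) t)) has_vector_derivative ?d m)
        (at t within {0..1})"
      by (simp add: k inner_diff_left dot_lmul_matrix algebra_simps)
  qed
  also have "(\<Sum>m<k. ?d m) = (inner (?p 0) (z k t) - inner (?p k) (z 0 t))
      + (\<Sum>m<k. inner (\<psi> t) (A (k - Suc m) *v z (k - Suc m) t))"
    using sum_lessThan_telescope'[of "\<lambda>m. inner (?p m) (z (k - m) t)" k]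
    by (simp add: sum.distrib)
  also have "\<dots> = - inner (\<psi> t) (z k t) + inner (\<psi> t) (\<Sum>j<k. A j *v z j t)"
    using sum.nat_diff_reindex[of "\<lambda>j. inner (\<psi> t) (A j *v z j t)" k]
    by (simp add: costate_0 costate_top[OF EL] inner_sum_right)
  also have "\<dots> = - inner (\<psi> t) (z k t - (\<Sum>j<k. A j *v z j t))"
    by (simp add: inner_diff_right)
  finally show ?thesis .
qed

section \<open>Sufficiency of the Euler--Lagrange and maximum conditions\<close>

lemma semilinear_sum_lessThan:
  fixes A :: "nat \<Rightarrow> real^'n^'m"
  assumes "k \<ge> 1"
  shows "A 0 *v v 0 + (\<Sum>j=1..k-1. A j *v v j) = (\<Sum>j<k. A j *v v j)"
  using assms by (cases k) (simp_all add: sum.atLeast1_atMost_eq sum.lessThan_Suc_shift del: sum.lessThan_Suc)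

lemma dual_tangent_coneD:
  assumes "w \<in> dual_tangent_cone Q x" "y \<in> Q"
  shows "inner w (y - x) \<ge> 0"
proof -
  have "1 *\<^sub>R (y - x) \<in> tangent_cone Q x"
    using assms(2) unfolding tangent_cone_def by (blast intro: zero_less_one)
  then show ?thesis
    using assms(1) by (auto simp: dual_tangent_cone_def inner_commute)
qed

theorem theorem3p2:
  fixes \<kappa> :: nat
    and pos :: "'k::finite \<Rightarrow> nat"
    and A :: "nat \<Rightarrow> real^'n^'n"
    and B :: "real^'r^'n"
    and U :: "(real^'r) set"
    and \<phi> :: "real^'n^'k \<Rightarrow> real"
    and Q :: "nat \<Rightarrow> (real^'n) set"
    and x :: "real \<Rightarrow> real^'n"
    and u :: "real \<Rightarrow> real^'r"
  assumes "\<kappa> \<ge> 1"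
    and "bij_betw pos UNIV {..<\<kappa>}"
    and "convex U"
    and "continuous_on UNIV \<phi>" and "convex_on UNIV \<phi>"
    and "\<And>j. j < \<kappa> \<Longrightarrow> convex (Q j)"
    and "feasible \<kappa> A B U Q x"
    and "corresponds_to_control \<kappa> A B U x u"
    and "\<exists>xs. trajectory_regular \<kappa> xs \<and>
      (AE t\<in>{0..1} in lebesgue.
         (-1) ^ \<kappa> *\<^sub>R nderiv \<kappa> xs t =
           (\<Sum>j<\<kappa>. (-1) ^ j *\<^sub>R (transpose (A j) *v nderiv j xs t))) \<and>
      (\<forall>j\<in>{1..\<kappa>-1}. (-1) ^ (j + 1) *\<^sub>R nderiv j xs 0 + eta \<kappa> A xs j 0
         \<in> dual_tangent_cone (Q (\<kappa> - j - 1)) (nderiv (\<kappa> - j - 1) x 0)) \<and>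
      - xs 0 \<in> dual_tangent_cone (Q (\<kappa> - 1)) (nderiv (\<kappa> - 1) x 0) \<and>
      (\<chi> i. (-1) ^ (\<kappa> - pos i) *\<^sub>R nderiv (\<kappa> - 1 - pos i) xs 1 + eta \<kappa> A xs (\<kappa> - 1 - pos i) 1)
         \<in> subdifferential \<phi> (endpoint pos x) \<and>
      (AE t\<in>{0..1} in lebesgue.
         ereal (inner (B *v u t) (xs t)) = (SUP v\<in>U. ereal (inner (B *v v) (xs t))))"
  shows "optimal \<kappa> pos A B U Q \<phi> x"
  unfolding optimal_def
proof (intro conjI allI impI)
  show "feasible \<kappa> A B U Q x" by fact
  obtain \<psi> where \<psi>: "trajectory_regular \<kappa> \<psi>"
    and EL: "AE t\<in>{0..1} in lebesgue. (-1) ^ \<kappa> *\<^sub>R nderiv \<kappa> \<psi> t =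
        (\<Sum>j<\<kappa>. (-1) ^ j *\<^sub>R (transpose (A j) *v nderiv j \<psi> t))"
    and cone: "\<forall>j\<in>{1..\<kappa>-1}. (-1) ^ (j + 1) *\<^sub>R nderiv j \<psi> 0 + eta \<kappa> A \<psi> j 0
        \<in> dual_tangent_cone (Q (\<kappa> - j - 1)) (nderiv (\<kappa> - j - 1) x 0)"
    and cone0: "- \<psi> 0 \<in> dual_tangent_cone (Q (\<kappa> - 1)) (nderiv (\<kappa> - 1) x 0)"
    and subgrad: "(\<chi> i. (-1) ^ (\<kappa> - pos i) *\<^sub>R nderiv (\<kappa> - 1 - pos i) \<psi> 1
          + eta \<kappa> A \<psi> (\<kappa> - 1 - pos i) 1) \<in> subdifferential \<phi> (endpoint pos x)" (is "?w \<in> _")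
    and maximum: "AE t\<in>{0..1} in lebesgue.
        ereal (inner (B *v u t) (\<psi> t)) = (SUP v\<in>U. ereal (inner (B *v v) (\<psi> t)))"
    using assms(9) by blast
  fix y assume y: "feasible \<kappa> A B U Q y"
  \<comment> \<open>\<open>z j\<close> stands for the \<open>j\<close>-th derivative of \<open>y - x\<close>. Defining it by differences avoids the operator
    \<open>nderiv\<close> on \<open>y - x\<close>, which is not additive where derivatives fail to exist.\<close>
  define z where "z j t = nderiv j y t - nderiv j x t" for j t
  define \<Phi> where "\<Phi> t = (\<Sum>m<\<kappa>. inner (costate \<kappa> A \<psi> m t) (z (\<kappa> - Suc m) t))" for t
  have x_reg: "trajectory_regular \<kappa> x" and y_reg: "trajectory_regular \<kappa> y"
    using \<open>feasible \<kappa> A B U Q x\<close> y by (auto simp: feasible_def)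

  have "AE t\<in>{0..1} in lebesgue. nderiv \<kappa> x t = (\<Sum>j<\<kappa>. A j *v nderiv j x t) + B *v u t"
    using assms(8) unfolding corresponds_to_control_def
      semilinear_sum_lessThan[OF \<open>\<kappa> \<ge> 1\<close>, of A "\<lambda>j. nderiv j x _", simplified nderiv.simps(1)]
    by blast
  moreover have "AE t\<in>{0..1} in lebesgue. \<exists>v\<in>U. nderiv \<kappa> y t = (\<Sum>j<\<kappa>. A j *v nderiv j y t) + B *v v"
    using y unfolding feasible_def semilinear_map_def
      semilinear_sum_lessThan[OF \<open>\<kappa> \<ge> 1\<close>, of A "\<lambda>j. nderiv j y _"]
    by (auto elim!: eventually_mono)
  moreover note trajectory_regular_derivatives[OF x_reg] trajectory_regular_derivatives[OF y_reg]
    trajectory_regular_derivatives[OF \<psi>] EL maximum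
  ultimately have deriv: "AE t\<in>{0..1} in lebesgue. \<exists>D\<ge>0. (\<Phi> has_vector_derivative D) (at t within {0..1})"
  proof eventually_elim
    case (elim t)
    show ?case
    proof
      assume t: "t \<in> {0..1}"
      obtain v where v: "v \<in> U" "nderiv \<kappa> y t = (\<Sum>j<\<kappa>. A j *v nderiv j y t) + B *v v"
        using elim t by blast
      have xt: "nderiv \<kappa> x t = (\<Sum>j<\<kappa>. A j *v nderiv j x t) + B *v u t"
        using elim t by blast
      have "(z j has_vector_derivative z (Suc j) t) (at t within {0..1})" if "j < \<kappa>" for j
        unfolding z_def[abs_def] using elim t that by (intro has_vector_derivative_diff) blast+
      then have "(\<Phi> has_vector_derivative - inner (\<psi> t) (z \<kappa> t - (\<Sum>j<\<kappa>. A j *v z j t)))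
          (at t within {0..1})"
        unfolding \<Phi>_def[abs_def]
        using elim t by (intro costate_pairing_has_vector_derivative) blast+
      moreover have "z \<kappa> t - (\<Sum>j<\<kappa>. A j *v z j t) = B *v v - B *v u t"
        by (simp add: z_def v(2) xt matrix_vector_mult_diff_distrib sum_subtractf)
      moreover have "inner (B *v v) (\<psi> t) \<le> inner (B *v u t) (\<psi> t)"
      proof -
        have "ereal (inner (B *v v) (\<psi> t)) \<le> (SUP v\<in>U. ereal (inner (B *v v) (\<psi> t)))"
          using v(1) by (rule SUP_upper)
        then show ?thesis using elim t by (metis ereal_less_eq(3))
      qed
      ultimately show "\<exists>D\<ge>0. (\<Phi> has_vector_derivative D) (at t within {0..1})"
        by (intro exI[of _ "inner (B *v u t) (\<psi> t) - inner (B *v v) (\<psi> t)"])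
           (simp add: inner_diff_right inner_commute)
    qed
  qed
  have ac: "absolutely_continuous_on {0..1} \<Phi>"
  proof -
    have "absolutely_continuous_on {0..1} (nderiv j x)" "absolutely_continuous_on {0..1} (nderiv j y)"
      if "j < \<kappa>" for j
      using x_reg y_reg that unfolding trajectory_regular_def by blast+
    then show ?thesis
      unfolding \<Phi>_def[abs_def] z_def
      by (intro absolutely_continuous_on_sum absolutely_continuous_on_inner
          absolutely_continuous_on_diff costate_absolutely_continuous[OF \<psi>]) auto
  qed
  have "\<Phi> 0 \<le> \<Phi> 1"
    using absolutely_continuous_on_nondecreasing[OF _ ac deriv] by simp

  have "0 \<le> \<Phi> 0"
    unfolding \<Phi>_def
  proof (rule sum_nonneg)
    fix m assume "m \<in> {..<\<kappa>}"
    then have m: "m < \<kappa>" by simp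
    have "costate \<kappa> A \<psi> m 0 \<in> dual_tangent_cone (Q (\<kappa> - Suc m)) (nderiv (\<kappa> - Suc m) x 0)"
    proof (cases "m = 0")
      case True
      then show ?thesis using cone0 by (simp add: costate_0)
    next
      case False
      then have "m \<in> {1..\<kappa>-1}" using m by auto
      then show ?thesis using cone unfolding costate_def by fastforce
    qed
    moreover have "nderiv (\<kappa> - Suc m) y 0 \<in> Q (\<kappa> - Suc m)"
      using y m unfolding feasible_def by simp
    ultimately show "0 \<le> inner (costate \<kappa> A \<psi> m 0) (z (\<kappa> - Suc m) 0)"
      unfolding z_def by (rule dual_tangent_coneD)
  qed

  have "\<Phi> 1 = inner ?w (endpoint pos y - endpoint pos x)"
  proof -
    have pos: "pos i < \<kappa>" for i
      using bij_betwE[OF assms(2)] by auto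
    have "\<Phi> 1 = (\<Sum>m<\<kappa>. inner (costate \<kappa> A \<psi> (\<kappa> - Suc (\<kappa> - Suc m)) 1) (z (\<kappa> - Suc m) 1))"
      unfolding \<Phi>_def by (intro sum.cong) auto
    also have "\<dots> = (\<Sum>j<\<kappa>. inner (costate \<kappa> A \<psi> (\<kappa> - Suc j) 1) (z j 1))"
      by (rule sum.nat_diff_reindex)
    also have "\<dots> = (\<Sum>i\<in>UNIV. inner (costate \<kappa> A \<psi> (\<kappa> - Suc (pos i)) 1) (z (pos i) 1))"
      by (rule sum.reindex_bij_betw[OF assms(2), symmetric])
    also have "\<dots> = inner ?w (endpoint pos y - endpoint pos x)"
      using pos by (simp add: inner_vec_def endpoint_def z_def costate_def Suc_diff_Suc
          flip: power_Suc)
    finally show ?thesis .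
  qed
  also have "\<dots> \<le> \<phi> (endpoint pos y) - \<phi> (endpoint pos x)"
    using subgrad by (simp add: subdifferential_def)
  finally show "\<phi> (endpoint pos x) \<le> \<phi> (endpoint pos y)"
    using \<open>0 \<le> \<Phi> 0\<close> \<open>\<Phi> 0 \<le> \<Phi> 1\<close> by linarith
qed

end
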